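(* Let $1\le k\le n$, $0<\alpha<1$, and let $P_1,\dots,P_n$ be $p$-values for null hypotheses $H_1,\dots,H_n$, with intersection null hypothesis $H_0=\bigcap_{i=1}^nH_i$. Assume that under $H_0$ each $P_i$ is uniform on $(0,1)$ and that all $k$-dimensional subvectors $(P_j)_{j\in J}$, $J\subseteq\{1,\dots,n\}$, $|J|=k$, have the same joint distribution; let $G_k(u)=\Pr_{H_0}\{\max_{j\in J}P_j\le u\}$, $0<u<1$, be the common c.d.f. of the maximum of any $k$ of the $p$-values under $H_0$. Let $\alpha_k\le\cdots\le\alpha_n$ be defined by $$G_k(\alpha_i)=\frac{i(i-1)\cdots(i-k+1)}{n(n-1)\cdots(n-k+1)}\,\alpha,\qquad i=k,\dots,n.$$ Consider the generalized Simes' test, which rejects $H_0$ if and only if $P_{i:n}\le\alpha_{\max(i,k)}$ for at least one $i=1,\dots,n$. Then: (1) if $P_1,\dots,P_n$ are i.i.d. under $H_0$, the test controls the $k$-FWER at $\alpha$ exactly, i.e. $\Pr_{H_0}\left\{\bigcup_{i=k}^{n}(P_{i:n}\le\alpha_i)\right\}=\alpha$; (2) if $(P_1,\dots,P_n)$ is $\mathrm{MTP}_2$ under $H_0$ (with common $k$th-order joint distributions as assumed), the test controls the $k$-FWER at $\alpha$ conservatively, i.e. $\Pr_{H_0}\left\{\bigcup_{i=k}^{n}(P_{i:n}\le\alpha_i)\right\}\le\alpha$.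
   Context: $P_{1:n}\le\cdots\le P_{n:n}$ are the ordered $p$-values, with corresponding null hypotheses $H_{(1)},\dots,H_{(n)}$. The generalized Simes' test corresponds to the stepup procedure rejecting $H_{(i)}$ for all $i\le\max\{j:P_{j:n}\le\alpha_{\max(j,k)}\}$ (rejecting none if no such $j$ exists). For this test, control of the $k$-FWER is meant in the weak sense: the $k$-FWER is the probability, under the intersection null hypothesis $H_0$, that this procedure rejects $k$ or more of the component hypotheses $H_1,\dots,H_n$, namely $\Pr_{H_0}\{\bigcup_{i=k}^{n}(P_{i:n}\le\alpha_i)\}$. (It is not the probability of rejecting $H_0$.) $\mathrm{MTP}_2$ (multivariate totally positive of order two): a function $f\ge 0$ on a product of totally ordered spaces is $\mathrm{MTP}_2$ if $f(\mathbf{x}\vee\mathbf{y})f(\mathbf{x}\wedge\mathbf{y})\ge f(\mathbf{x})f(\mathbf{y})$ for all $\mathbf{x},\mathbf{y}$, where $\vee,\wedge$ are the coordinatewise maximum and minimum. A random vector is $\mathrm{MTP}_2$ if it has a density, with respect to a product of $\sigma$-finite measures on the coordinates, that is $\mathrm{MTP}_2$. *)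

theory Defs
  imports "HOL-Probability.Probability"
begin

text \<open>Hypotheses are indexed by \<open>{1..n}\<close>, and \<open>p j\<close> is the realised p-value for the hypothesis
  with index \<open>j\<close>.  The list \<open>ordering n p\<close> is \<open>[(1), \<dots>, (n)]\<close>: its entry number \<open>i - 1\<close> is the
  index of the hypothesis \<open>H\<^sub>(\<^sub>i\<^sub>)\<close>.  Ties are broken by the smaller index.\<close>

definition ordering :: "nat \<Rightarrow> (nat \<Rightarrow> real) \<Rightarrow> nat list" where
  "ordering n p = sort_key p [1..<Suc n]"

definition ordered_pval :: "nat \<Rightarrow> (nat \<Rightarrow> real) \<Rightarrow> nat \<Rightarrow> real" where
  "ordered_pval n p i = p (ordering n p ! (i - 1))"

definition simes_rejects ::
    "nat \<Rightarrow> nat \<Rightarrow> (nat \<Rightarrow> real) \<Rightarrow> (nat \<Rightarrow> real) \<Rightarrow> bool" where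
  "simes_rejects n k a p \<longleftrightarrow> (\<exists>i\<in>{1..n}. ordered_pval n p i \<le> a (max i k))"

text \<open>The value \<open>0\<close> stands for the case in which no \<open>j\<close> qualifies and nothing is rejected.\<close>

definition stepup_cutoff ::
    "nat \<Rightarrow> nat \<Rightarrow> (nat \<Rightarrow> real) \<Rightarrow> (nat \<Rightarrow> real) \<Rightarrow> nat" where
  "stepup_cutoff n k a p =
     Max (insert 0 {j \<in> {1..n}. ordered_pval n p j \<le> a (max j k)})"

definition stepup_rejected ::
    "nat \<Rightarrow> nat \<Rightarrow> (nat \<Rightarrow> real) \<Rightarrow> (nat \<Rightarrow> real) \<Rightarrow> nat set" where
  "stepup_rejected n k a p =
     (\<lambda>i. ordering n p ! (i - 1)) ` {1..stepup_cutoff n k a p}"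

text \<open>This is the weak sense of the k-FWER: \<open>M\<close> is meant to be a distribution under the
  intersection null hypothesis, so every rejection is a false one.\<close>

definition kFWER ::
    "'a measure \<Rightarrow> nat \<Rightarrow> nat \<Rightarrow> (nat \<Rightarrow> real) \<Rightarrow> (nat \<Rightarrow> 'a \<Rightarrow> real) \<Rightarrow> real" where
  "kFWER M n k a P =
     measure M {\<omega> \<in> space M. k \<le> card (stepup_rejected n k a (\<lambda>j. P j \<omega>))}"

text \<open>The joint distribution of the subvector \<open>(P\<^sub>j)\<close>, \<open>j \<in> J\<close>, is taken on a common index set
  \<open>{..<card J}\<close>, with the coordinates listed by increasing \<open>j\<close>.\<close>

definition subvector_distr ::
    "'a measure \<Rightarrow> (nat \<Rightarrow> 'a \<Rightarrow> real) \<Rightarrow> nat set \<Rightarrow> (nat \<Rightarrow> real) measure" where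
  "subvector_distr M P J =
     distr M (PiM {..<card J} (\<lambda>_. borel))
       (\<lambda>\<omega>. \<lambda>i\<in>{..<card J}. P (sorted_list_of_set J ! i) \<omega>)"

definition MTP2_fun :: "'i set \<Rightarrow> (('i \<Rightarrow> 'b::linorder) \<Rightarrow> real) \<Rightarrow> bool" where
  "MTP2_fun I f \<longleftrightarrow>
     (\<forall>x \<in> I \<rightarrow>\<^sub>E UNIV. 0 \<le> f x) \<and>
     (\<forall>x \<in> I \<rightarrow>\<^sub>E UNIV. \<forall>y \<in> I \<rightarrow>\<^sub>E UNIV.
        f x * f y \<le> f (\<lambda>i\<in>I. max (x i) (y i)) * f (\<lambda>i\<in>I. min (x i) (y i)))"

definition MTP2 :: "'a measure \<Rightarrow> 'i set \<Rightarrow> ('i \<Rightarrow> 'a \<Rightarrow> real) \<Rightarrow> bool" where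
  "MTP2 M I X \<longleftrightarrow>
     (\<exists>\<mu> f. (\<forall>i\<in>I. sigma_finite_measure (\<mu> i) \<and> sets (\<mu> i) = sets borel) \<and>
            MTP2_fun I f \<and>
            distributed M (PiM I \<mu>) (\<lambda>\<omega>. \<lambda>i\<in>I. X i \<omega>) (\<lambda>x. ennreal (f x)))"

lemma length_ordering [simp]: "length (ordering n p) = n"
  by (simp add: ordering_def)

lemma distinct_ordering: "distinct (ordering n p)"
  by (simp add: ordering_def)

lemma set_ordering: "set (ordering n p) = {1..n}"
  by (auto simp: ordering_def)

lemma ordered_pval_mono:
  assumes "1 \<le> i" "i \<le> j" "j \<le> n"
  shows "ordered_pval n p i \<le> ordered_pval n p j"
proof -
  have "sorted (map p (ordering n p))"
    by (simp add: ordering_def)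
  then show ?thesis
    using assms sorted_nth_mono[of "map p (ordering n p)" "i - 1" "j - 1"]
    by (simp add: ordered_pval_def)
qed

lemma stepup_cutoff_le: "stepup_cutoff n k a p \<le> n"
  by (simp add: stepup_cutoff_def)

lemma card_stepup_rejected: "card (stepup_rejected n k a p) = stepup_cutoff n k a p"
proof -
  have "inj_on (\<lambda>i. ordering n p ! (i - 1)) {1..stepup_cutoff n k a p}"
    using stepup_cutoff_le[of n k a p] distinct_ordering[of n p]
    by (auto simp: inj_on_def nth_eq_iff_index_eq)
  then show ?thesis
    by (simp add: stepup_rejected_def card_image)
qed

lemma le_stepup_cutoff_iff:
  assumes "1 \<le> m"
  shows "m \<le> stepup_cutoff n k a p \<longleftrightarrow> (\<exists>i\<in>{m..n}. ordered_pval n p i \<le> a (max i k))"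
  using assms by (subst stepup_cutoff_def, subst Max_ge_iff) (auto, use le_trans in blast)

lemma simes_rejects_iff: "simes_rejects n k a p \<longleftrightarrow> stepup_rejected n k a p \<noteq> {}"
  using le_stepup_cutoff_iff[of 1 n k a p]
  by (auto simp: simes_rejects_def stepup_rejected_def)

lemma kFWER_eq:
  assumes "1 \<le> k"
  shows "kFWER M n k a P =
    measure M (\<Union>i\<in>{k..n}. {\<omega> \<in> space M. ordered_pval n (\<lambda>j. P j \<omega>) i \<le> a i})"
proof -
  have "{\<omega> \<in> space M. k \<le> card (stepup_rejected n k a (\<lambda>j. P j \<omega>))} =
    (\<Union>i\<in>{k..n}. {\<omega> \<in> space M. ordered_pval n (\<lambda>j. P j \<omega>) i \<le> a i})"
    using assms by (auto simp: card_stepup_rejected le_stepup_cutoff_iff max_absorb1)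
  then show ?thesis
    by (simp add: kFWER_def)
qed

end

theory Submission
  imports Defs
begin

text \<open>Let \<open>R\<close> be the largest \<open>i \<ge> k\<close> with \<open>P\<^sub>i\<^sub>:\<^sub>n \<le> \<alpha>\<^sub>i\<close>.  On \<open>R = r\<close> exactly \<open>r\<close> p-values are at
  most \<open>\<alpha>\<^sub>r\<close>, so summing over the sets \<open>J\<close> of \<open>k\<close> indices and dividing by \<open>r choose k\<close>, which is
  proportional to \<open>G (\<alpha>\<^sub>r)\<close>, expresses the k-FWER as \<open>\<alpha>\<close> times the average over \<open>J\<close> of
  \<open>\<Sum>r. Pr (R = r | max\<^sub>J P \<le> \<alpha>\<^sub>r)\<close>.  Under this conditioning \<open>R\<close> is a function of the p-values
  outside \<open>J\<close>, so under independence the inner sum is \<open>1\<close>.  Under \<open>MTP\<^sub>2\<close> the four functions theorem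
  shows that the conditional probability of a decreasing event given \<open>max\<^sub>J P \<le> u\<close> is nonincreasing
  in \<open>u\<close>, and the inner sum is bounded by a telescoping sum with value \<open>1\<close>.\<close>

section \<open>The four functions theorem on finite products, and its form for MTP2 vectors\<close>

lemma ennreal_add_le_add_of_mult_le:
  fixes a b c d :: ennreal
  assumes "a \<le> c" "b \<le> c" "a * b \<le> c * d"
  shows "a + b \<le> c + d"
proof (cases "c = top \<or> d = top")
  case True
  then show ?thesis by auto
next
  case False
  then obtain c' where c: "c = ennreal c'" "0 \<le> c'" by (cases c) auto
  obtain d' where d: "d = ennreal d'" "0 \<le> d'" using False by (cases d) auto
  obtain a' where a: "a = ennreal a'" "0 \<le> a'"
    using assms(1) c by (cases a) (auto simp: top_unique)
  obtain b' where b: "b = ennreal b'" "0 \<le> b'"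
    using assms(2) c by (cases b) (auto simp: top_unique)
  have le: "a' \<le> c'" "b' \<le> c'" "a' * b' \<le> c' * d'"
    using assms a b c d by (simp_all flip: ennreal_mult)
  have "a' + b' \<le> c' + d'"
  proof (cases "c' = 0")
    case True
    then show ?thesis using le d by auto
  next
    case False
    \<comment> \<open>Expanding the product and replacing \<open>a' * b'\<close> by the larger
      \<open>c' * d'\<close> gives the claim multiplied by \<open>c'\<close>.\<close>
    have "0 \<le> (c' - a') * (c' - b')" using le by simp
    then have "c' * (a' + b') \<le> c' * (c' + d')"
      using le(3) by (simp add: algebra_simps)
    then show ?thesis using False c by simp
  qed
  then show ?thesis using a b c d by (simp flip: ennreal_plus)
qed

text \<open>Symmetrising both sides in the two integration variables reduces the claim to a pointwise
  inequality.\<close>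

lemma four_functions_line:
  fixes f1 f2 f3 f4 :: "'b::linorder \<Rightarrow> ennreal"
  assumes [measurable]: "f1 \<in> borel_measurable \<mu>" "f2 \<in> borel_measurable \<mu>"
    "f3 \<in> borel_measurable \<mu>" "f4 \<in> borel_measurable \<mu>"
    and le: "\<And>s t. f1 s * f2 t \<le> f3 (min s t) * f4 (max s t)"
  shows "(\<integral>\<^sup>+x. f1 x \<partial>\<mu>) * (\<integral>\<^sup>+x. f2 x \<partial>\<mu>) \<le> (\<integral>\<^sup>+x. f3 x \<partial>\<mu>) * (\<integral>\<^sup>+x. f4 x \<partial>\<mu>)"
proof -
  have sym: "(\<integral>\<^sup>+x. (\<integral>\<^sup>+y. f x * g y + f y * g x \<partial>\<mu>) \<partial>\<mu>)
      = 2 * ((\<integral>\<^sup>+x. f x \<partial>\<mu>) * (\<integral>\<^sup>+x. g x \<partial>\<mu>))"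
    if [measurable]: "f \<in> borel_measurable \<mu>" "g \<in> borel_measurable \<mu>" for f g :: "'b \<Rightarrow> ennreal"
    by (simp add: nn_integral_add nn_integral_cmult nn_integral_multc mult_2)
  have pt: "f1 x * f2 y + f1 y * f2 x \<le> f3 x * f4 y + f3 y * f4 x" for x y
  proof -
    \<comment> \<open>For x \<le> y both terms on the left have meet x and join y, so the single
      term \<open>f3 x * f4 y\<close> dominates each of them and takes the place of
      \<open>c\<close>.\<close>
    have *: "f1 x * f2 y + f1 y * f2 x \<le> f3 x * f4 y + f3 y * f4 x" if "x \<le> y" for x y
    proof (rule ennreal_add_le_add_of_mult_le)
      show "f1 x * f2 y \<le> f3 x * f4 y" "f1 y * f2 x \<le> f3 x * f4 y"
        using le[of x y] le[of y x] that by (simp_all add: min_def max_def split: if_splits)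
      \<comment> \<open>The condition on the products comes from the diagonal cases s = t = x and s
        = t = y, with the factors regrouped.\<close>
      have "(f1 x * f2 x) * (f1 y * f2 y) \<le> (f3 x * f4 x) * (f3 y * f4 y)"
        using mult_mono[OF le[of x x] le[of y y]] by simp
      then show "(f1 x * f2 y) * (f1 y * f2 x) \<le> (f3 x * f4 y) * (f3 y * f4 x)"
        by (simp add: ac_simps)
    qed
    show ?thesis
      using *[of x y] *[of y x] by (cases "x \<le> y") (simp_all add: ac_simps)
  qed
  have "2 * ((\<integral>\<^sup>+x. f1 x \<partial>\<mu>) * (\<integral>\<^sup>+x. f2 x \<partial>\<mu>)) \<le> 2 * ((\<integral>\<^sup>+x. f3 x \<partial>\<mu>) * (\<integral>\<^sup>+x. f4 x \<partial>\<mu>))"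
    by (subst (1 2) sym[symmetric]) (auto intro!: nn_integral_mono pt)
  then show ?thesis
    by (simp add: ennreal_mult_le_mult_iff)
qed

text \<open>Induction on the number of coordinates. Integrating out one coordinate at fixed x and y
  is the one-dimensional case, and it shows that the four partial integrals satisfy the same
  hypothesis on the remaining coordinates.\<close>

theorem four_functions_PiM:
  fixes \<mu> :: "'i \<Rightarrow> 'b::linorder measure" and f1 f2 f3 f4 :: "('i \<Rightarrow> 'b) \<Rightarrow> ennreal"
  assumes "finite I"
    and sf: "\<And>i. sigma_finite_measure (\<mu> i)" and sp: "\<And>i. space (\<mu> i) = UNIV"
    and "f1 \<in> borel_measurable (PiM I \<mu>)" "f2 \<in> borel_measurable (PiM I \<mu>)"
      "f3 \<in> borel_measurable (PiM I \<mu>)" "f4 \<in> borel_measurable (PiM I \<mu>)"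
    and "\<And>x y. x \<in> I \<rightarrow>\<^sub>E UNIV \<Longrightarrow> y \<in> I \<rightarrow>\<^sub>E UNIV \<Longrightarrow>
      f1 x * f2 y \<le> f3 (\<lambda>i\<in>I. min (x i) (y i)) * f4 (\<lambda>i\<in>I. max (x i) (y i))"
  shows "(\<integral>\<^sup>+x. f1 x \<partial>PiM I \<mu>) * (\<integral>\<^sup>+x. f2 x \<partial>PiM I \<mu>)
    \<le> (\<integral>\<^sup>+x. f3 x \<partial>PiM I \<mu>) * (\<integral>\<^sup>+x. f4 x \<partial>PiM I \<mu>)"
  using assms(1,4-8)
proof (induction I arbitrary: f1 f2 f3 f4 rule: finite_induct)
  case empty
  \<comment> \<open>The empty product is a single point, the function that is
    \<open>undefined\<close> everywhere, so the claim is the hypothesis at that point.\<close>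
  show ?case
    using empty.prems(5)[of "\<lambda>_. undefined" "\<lambda>_. undefined"]
    by (simp add: PiM_empty nn_integral_count_space_finite restrict_def)
next
  case (insert i I)
  interpret product_sigma_finite \<mu> using sf by (simp add: product_sigma_finite_def)
  have m1: "(\<lambda>(x, t). f (x(i := t))) \<in> borel_measurable (PiM I \<mu> \<Otimes>\<^sub>M \<mu> i)"
    if "f \<in> borel_measurable (PiM (insert i I) \<mu>)" for f :: "('i \<Rightarrow> 'b) \<Rightarrow> ennreal"
    using measurable_compose[OF measurable_add_dim that] by (simp add: case_prod_beta)
  have m: "(\<lambda>x. \<integral>\<^sup>+t. f (x(i := t)) \<partial>\<mu> i) \<in> borel_measurable (PiM I \<mu>)"
    if "f \<in> borel_measurable (PiM (insert i I) \<mu>)" for f :: "('i \<Rightarrow> 'b) \<Rightarrow> ennreal"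
    by (rule sigma_finite_measure.borel_measurable_nn_integral[OF sf m1[OF that]])
  have m2: "(\<lambda>t. f (x(i := t))) \<in> borel_measurable (\<mu> i)"
    if "f \<in> borel_measurable (PiM (insert i I) \<mu>)" "x \<in> I \<rightarrow>\<^sub>E UNIV"
    for f :: "('i \<Rightarrow> 'b) \<Rightarrow> ennreal" and x
    using measurable_Pair2[OF m1[OF that(1)], of x] that(2) by (simp add: space_PiM sp)
  show ?case
    unfolding product_nn_integral_insert[OF insert.hyps insert.prems(1)]
      product_nn_integral_insert[OF insert.hyps insert.prems(2)]
      product_nn_integral_insert[OF insert.hyps insert.prems(3)]
      product_nn_integral_insert[OF insert.hyps insert.prems(4)]
  proof (rule insert.IH)
    fix x y :: "'i \<Rightarrow> 'b" assume xy: "x \<in> I \<rightarrow>\<^sub>E UNIV" "y \<in> I \<rightarrow>\<^sub>E UNIV"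
    define u where "u = (\<lambda>i\<in>I. min (x i) (y i))"
    define v where "v = (\<lambda>i\<in>I. max (x i) (y i))"
    have uv: "u \<in> I \<rightarrow>\<^sub>E UNIV" "v \<in> I \<rightarrow>\<^sub>E UNIV" by (auto simp: u_def v_def)
    have "f1 (x(i := s)) * f2 (y(i := t)) \<le> f3 (u(i := min s t)) * f4 (v(i := max s t))" for s t
    proof -
      have "(\<lambda>j\<in>insert i I. min ((x(i := s)) j) ((y(i := t)) j)) = u(i := min s t)"
        "(\<lambda>j\<in>insert i I. max ((x(i := s)) j) ((y(i := t)) j)) = v(i := max s t)"
        using insert.hyps by (auto simp: u_def v_def fun_eq_iff)
      moreover have "x(i := s) \<in> insert i I \<rightarrow>\<^sub>E UNIV" "y(i := t) \<in> insert i I \<rightarrow>\<^sub>E UNIV"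
        using xy by (auto simp: PiE_iff extensional_def)
      ultimately show ?thesis
        using insert.prems(5)[of "x(i := s)" "y(i := t)"] by metis
    qed
    then show "(\<integral>\<^sup>+t. f1 (x(i := t)) \<partial>\<mu> i) * (\<integral>\<^sup>+t. f2 (y(i := t)) \<partial>\<mu> i)
      \<le> (\<integral>\<^sup>+t. f3 (u(i := t)) \<partial>\<mu> i) * (\<integral>\<^sup>+t. f4 (v(i := t)) \<partial>\<mu> i)"
      using xy uv insert.prems by (intro four_functions_line m2) auto
  qed (intro m insert.prems)+
qed

text \<open>This is the four functions theorem for the density cut down to \<open>A\<close>,
  \<open>B\<close>, \<open>C\<close> and \<open>D\<close>. The inclusions \<open>meet\<close> and
  \<open>join\<close> handle the indicators, and the MTP2 inequality handles the density.\<close>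

lemma MTP2_meet_join:
  fixes X :: "'i \<Rightarrow> 'a \<Rightarrow> real"
  assumes "prob_space M" "finite I" "MTP2 M I X"
    and A: "A \<in> sets (PiM I (\<lambda>_. borel))" and B: "B \<in> sets (PiM I (\<lambda>_. borel))"
    and C: "C \<in> sets (PiM I (\<lambda>_. borel))" and D: "D \<in> sets (PiM I (\<lambda>_. borel))"
    and meet: "\<And>x y. x \<in> A \<Longrightarrow> y \<in> B \<Longrightarrow> (\<lambda>i\<in>I. min (x i) (y i)) \<in> C"
    and join: "\<And>x y. x \<in> A \<Longrightarrow> y \<in> B \<Longrightarrow> (\<lambda>i\<in>I. max (x i) (y i)) \<in> D"
  shows "measure M {\<omega>\<in>space M. (\<lambda>i\<in>I. X i \<omega>) \<in> A} * measure M {\<omega>\<in>space M. (\<lambda>i\<in>I. X i \<omega>) \<in> B}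
    \<le> measure M {\<omega>\<in>space M. (\<lambda>i\<in>I. X i \<omega>) \<in> C} * measure M {\<omega>\<in>space M. (\<lambda>i\<in>I. X i \<omega>) \<in> D}"
proof -
  interpret prob_space M by fact
  obtain \<mu>0 f where mu0: "\<And>i. i \<in> I \<Longrightarrow> sigma_finite_measure (\<mu>0 i)"
      "\<And>i. i \<in> I \<Longrightarrow> sets (\<mu>0 i) = sets borel"
    and f: "MTP2_fun I f"
    and d0: "distributed M (PiM I \<mu>0) (\<lambda>\<omega>. \<lambda>i\<in>I. X i \<omega>) (\<lambda>x. ennreal (f x))"
    using assms(3) unfolding MTP2_def by blast
  \<comment> \<open>\<open>four_functions_PiM\<close> asks for its conditions at every index.
    Changing the measures outside \<open>I\<close> leaves the product measure as it is.\<close>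
  define \<mu> where "\<mu> i = (if i \<in> I then \<mu>0 i else null_measure borel)" for i
  have sf: "sigma_finite_measure (\<mu> i)" for i
    using mu0(1) by (auto simp: \<mu>_def intro!: finite_measure.sigma_finite_measure finite_measureI)
  have st: "sets (\<mu> i) = sets borel" for i using mu0(2) by (simp add: \<mu>_def)
  have sp: "space (\<mu> i) = UNIV" for i using sets_eq_imp_space_eq[OF st] by simp
  have "PiM I \<mu> = PiM I \<mu>0" by (rule PiM_cong) (auto simp: \<mu>_def)
  with d0 have d: "distributed M (PiM I \<mu>) (\<lambda>\<omega>. \<lambda>i\<in>I. X i \<omega>) (\<lambda>x. ennreal (f x))" by simp
  have S: "sets (PiM I \<mu>) = sets (PiM I (\<lambda>_. borel))"
    by (rule sets_PiM_cong) (auto simp: st)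
  have fm: "(\<lambda>x. ennreal (f x)) \<in> borel_measurable (PiM I \<mu>)"
    using d by (rule distributed_borel_measurable)
  have em: "ennreal (measure M {\<omega>\<in>space M. (\<lambda>i\<in>I. X i \<omega>) \<in> Z})
      = (\<integral>\<^sup>+x. ennreal (f x) * indicator Z x \<partial>PiM I \<mu>)"
    if "Z \<in> sets (PiM I (\<lambda>_. borel))" for Z
    using distributed_emeasure[OF d, of Z] that
    by (simp add: S emeasure_eq_measure vimage_def Int_def conj_commute)
  have "(\<integral>\<^sup>+x. ennreal (f x) * indicator A x \<partial>PiM I \<mu>) * (\<integral>\<^sup>+x. ennreal (f x) * indicator B x \<partial>PiM I \<mu>)
    \<le> (\<integral>\<^sup>+x. ennreal (f x) * indicator C x \<partial>PiM I \<mu>) * (\<integral>\<^sup>+x. ennreal (f x) * indicator D x \<partial>PiM I \<mu>)"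
  proof (rule four_functions_PiM[OF \<open>finite I\<close> sf sp])
    fix x y :: "'i \<Rightarrow> real" assume xy: "x \<in> I \<rightarrow>\<^sub>E UNIV" "y \<in> I \<rightarrow>\<^sub>E UNIV"
    let ?u = "\<lambda>i\<in>I. min (x i) (y i)" and ?v = "\<lambda>i\<in>I. max (x i) (y i)"
    show "ennreal (f x) * indicator A x * (ennreal (f y) * indicator B y)
      \<le> ennreal (f ?u) * indicator C ?u * (ennreal (f ?v) * indicator D ?v)"
    proof (cases "x \<in> A \<and> y \<in> B")
      case True
      have "f x * f y \<le> f ?v * f ?u" "0 \<le> f x" "0 \<le> f y" "0 \<le> f ?u" "0 \<le> f ?v"
        using f xy by (auto simp: MTP2_fun_def)
      then show ?thesis
        using True meet join by (simp add: ac_simps flip: ennreal_mult)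
    qed auto
  qed (use A B C D in \<open>auto simp: S intro!: borel_measurable_times_ennreal borel_measurable_indicator fm\<close>)
  then show ?thesis
    by (simp add: em[symmetric] A B C D flip: ennreal_mult)
qed

section \<open>Counts of small p-values, and crossings of the critical values\<close>

definition count_le :: "'i set \<Rightarrow> ('i \<Rightarrow> real) \<Rightarrow> real \<Rightarrow> nat" where
  "count_le K p t = card {j \<in> K. p j \<le> t}"

text \<open>The offset \<open>c\<close> accounts for \<open>c\<close> further coordinates that are known to be small.\<close>

definition crosses :: "'i set \<Rightarrow> nat \<Rightarrow> nat \<Rightarrow> (nat \<Rightarrow> real) \<Rightarrow> nat \<Rightarrow> ('i \<Rightarrow> real) \<Rightarrow> bool" where
  "crosses K c n a r p \<longleftrightarrow> (\<exists>i\<in>{r..n}. i \<le> c + count_le K p (a i))"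

text \<open>Trades order statistics for counts, so that sorting and ties do not enter the later
  argument. List positions start at 0: position \<open>m\<close> carries the order statistic with
  number \<open>Suc m\<close>.\<close>

lemma ordered_pval_le_iff:
  assumes "1 \<le> i" "i \<le> n"
  shows "ordered_pval n p i \<le> t \<longleftrightarrow> i \<le> count_le {1..n} p t"
proof -
  let ?xs = "ordering n p"
  have card: "count_le {1..n} p t = card {m. m < n \<and> p (?xs ! m) \<le> t}"
  proof -
    have "bij_betw (\<lambda>m. ?xs ! m) {m. m < n \<and> p (?xs ! m) \<le> t} {j \<in> {1..n}. p j \<le> t}"
      unfolding bij_betw_def
    proof
      show "inj_on ((!) ?xs) {m. m < n \<and> p (?xs ! m) \<le> t}"
        using distinct_ordering[of n p] by (auto simp: inj_on_def nth_eq_iff_index_eq)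
      show "(!) ?xs ` {m. m < n \<and> p (?xs ! m) \<le> t} = {j \<in> {1..n}. p j \<le> t}"
        unfolding set_ordering[of n p, symmetric] by (auto simp: set_conv_nth)
    qed
    then show ?thesis
      by (simp add: count_le_def bij_betw_same_card)
  qed
  show ?thesis
  proof
    assume *: "ordered_pval n p i \<le> t"
    have "{..<i} \<subseteq> {m. m < n \<and> p (?xs ! m) \<le> t}"
    proof
      fix m assume "m \<in> {..<i}"
      then show "m \<in> {m. m < n \<and> p (?xs ! m) \<le> t}"
        using ordered_pval_mono[of "Suc m" i n p] assms * by (auto simp: ordered_pval_def)
    qed
    then have "card {..<i} \<le> card {m. m < n \<and> p (?xs ! m) \<le> t}"
      by (intro card_mono) auto
    then show "i \<le> count_le {1..n} p t" by (simp only: card card_lessThan)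
  next
    assume *: "i \<le> count_le {1..n} p t"
    show "ordered_pval n p i \<le> t"
    proof (rule ccontr)
      assume n: "\<not> ordered_pval n p i \<le> t"
      have "{m. m < n \<and> p (?xs ! m) \<le> t} \<subseteq> {..<i - 1}"
      proof
        fix m assume m: "m \<in> {m. m < n \<and> p (?xs ! m) \<le> t}"
        show "m \<in> {..<i - 1}"
        proof (rule ccontr)
          assume "m \<notin> {..<i - 1}"
          then have "i \<le> Suc m" by simp
          then show False
            using ordered_pval_mono[of i "Suc m" n p] assms m n by (auto simp: ordered_pval_def)
        qed
      qed
      then have "card {m. m < n \<and> p (?xs ! m) \<le> t} \<le> i - 1"
        using card_mono[of "{..<i - 1}"] by fastforce
      then show False using * assms unfolding card by simp
    qed
  qed
qed

text \<open>Expresses a bound on the count as a finite Boolean combination of the conditions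
  \<open>p j \<le> t\<close>, from which measurability is read off.\<close>

lemma count_le_ge_iff:
  assumes "finite K"
  shows "i \<le> count_le K p t \<longleftrightarrow> (\<exists>T\<in>{T \<in> Pow K. i \<le> card T}. \<forall>j\<in>T. p j \<le> t)"
proof
  assume "i \<le> count_le K p t"
  then show "\<exists>T\<in>{T \<in> Pow K. i \<le> card T}. \<forall>j\<in>T. p j \<le> t"
    by (intro bexI[of _ "{j \<in> K. p j \<le> t}"]) (auto simp: count_le_def)
next
  assume "\<exists>T\<in>{T \<in> Pow K. i \<le> card T}. \<forall>j\<in>T. p j \<le> t"
  then obtain T where T: "T \<subseteq> K" "i \<le> card T" "\<forall>j\<in>T. p j \<le> t" by blast
  show "i \<le> count_le K p t"
    unfolding count_le_def
    by (rule order_trans[OF T(2) card_mono]) (use T assms in auto)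
qed

lemma crosses_measurable:
  assumes "finite K" "\<And>j. j \<in> K \<Longrightarrow> P j \<in> borel_measurable M"
  shows "{\<omega> \<in> space M. crosses K c n a r (\<lambda>j. P j \<omega>)} \<in> sets M"
proof -
  \<comment> \<open>The subtraction is truncated: for i \<le> c the empty \<open>T\<close> is a
    witness, and the left side holds trivially.\<close>
  have *: "i \<le> c + count_le K p t \<longleftrightarrow> (\<exists>T\<in>{T \<in> Pow K. i - c \<le> card T}. \<forall>j\<in>T. p j \<le> t)"
    for i p t
    by (subst count_le_ge_iff[OF assms(1), symmetric]) auto
  have "{\<omega> \<in> space M. crosses K c n a r (\<lambda>j. P j \<omega>)}
    = {\<omega> \<in> space M. \<exists>i\<in>{r..n}. \<exists>T\<in>{T \<in> Pow K. i - c \<le> card T}. \<forall>j\<in>T. P j \<omega> \<le> a i}"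
    by (simp only: crosses_def *)
  also have "\<dots> \<in> sets M"
    using assms by (intro sets.sets_Collect_finite_Ex sets.sets_Collect_finite_All borel_measurable_le)
      (auto intro: finite_subset)
  finally show ?thesis .
qed

lemma crosses_antimono_index: "r \<le> s \<Longrightarrow> crosses K c n a s p \<Longrightarrow> crosses K c n a r p"
  by (force simp: crosses_def)

text \<open>Lower p-values give larger counts, so a crossing is a decreasing event. Used in both
  directions, this also shows that a crossing depends only on the coordinates in
  \<open>K\<close>.\<close>

lemma crosses_lower:
  assumes "finite K" "\<And>j. j \<in> K \<Longrightarrow> q j \<le> p j" "crosses K c n a r p"
  shows "crosses K c n a r q"
proof -
  have "count_le K p t \<le> count_le K q t" for t
    unfolding count_le_def using assms(1,2) by (intro card_mono) (auto intro: order_trans)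
  then show ?thesis
    using assms(3) unfolding crosses_def by (meson add_left_mono order_trans)
qed

text \<open>The p-values in \<open>J\<close> lie below every critical value from index
  \<open>s\<close> on, so they add exactly \<open>k\<close> to each count concerned. Keeping
  \<open>s\<close> apart from \<open>r\<close> allows crossings from \<open>r\<close> and from
  \<open>Suc r\<close> to be compared on the same event.\<close>

lemma crosses_remove:
  assumes "finite I" "J \<subseteq> I" "card J = k" "mono_on {k..n} a" "k \<le> s" "s \<le> r"
    and "s \<le> n" and small: "\<And>j. j \<in> J \<Longrightarrow> p j \<le> a s"
  shows "crosses I 0 n a r p \<longleftrightarrow> crosses (I - J) k n a r p"
proof -
  have "count_le I p (a i) = k + count_le (I - J) p (a i)" if i: "i \<in> {r..n}" for i
  proof -
    have "a s \<le> a i" using i assms by (auto intro: mono_onD)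
    then have "{j \<in> I. p j \<le> a i} = J \<union> {j \<in> I - J. p j \<le> a i}"
      using small assms(2) by force
    moreover have "card (J \<union> {j \<in> I - J. p j \<le> a i}) = card J + card {j \<in> I - J. p j \<le> a i}"
      using assms(1,2) by (intro card_Un_disjoint) (auto intro: finite_subset)
    ultimately show ?thesis using assms(3) by (simp add: count_le_def)
  qed
  then show ?thesis by (auto simp: crosses_def)
qed

text \<open>If more than \<open>r\<close> p-values were at most \<open>a r\<close>, then
  \<open>Suc r\<close> would still be an admissible index, and by monotonicity of \<open>a\<close>
  there would be a crossing at it.\<close>

lemma count_le_last_crossing:
  assumes "finite I" "mono_on {k..card I} a" "k \<le> r"
    and "crosses I 0 (card I) a r p" "\<not> crosses I 0 (card I) a (Suc r) p"
  shows "count_le I p (a r) = r"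
proof -
  let ?n = "card I"
  obtain i where i: "i \<in> {r..?n}" "i \<le> count_le I p (a i)"
    using assms(4) by (auto simp: crosses_def)
  have "i = r"
    using i assms(5) by (force simp: crosses_def)
  have "\<not> r < count_le I p (a r)"
  proof
    assume *: "r < count_le I p (a r)"
    have "count_le I p (a r) \<le> ?n"
      using assms(1) by (auto simp: count_le_def intro: card_mono)
    then have "Suc r \<le> ?n" using * by simp
    then have "a r \<le> a (Suc r)" using assms by (auto intro: mono_onD)
    then have "count_le I p (a r) \<le> count_le I p (a (Suc r))"
      unfolding count_le_def using assms(1) by (intro card_mono) auto
    then show False
      using * \<open>Suc r \<le> ?n\<close> assms(5)
      unfolding crosses_def by (auto dest!: bspec[of _ _ "Suc r"])
  qed
  then show ?thesis using i \<open>i = r\<close> by simp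
qed

lemma card_subsets_le:
  assumes "finite I"
  shows "card {J. J \<subseteq> I \<and> card J = k \<and> (\<forall>j\<in>J. p j \<le> t)} = count_le I p t choose k"
proof -
  have "{J. J \<subseteq> I \<and> card J = k \<and> (\<forall>j\<in>J. p j \<le> t)} = {J. J \<subseteq> {j \<in> I. p j \<le> t} \<and> card J = k}"
    by auto
  then show ?thesis
    using assms by (simp add: count_le_def n_subsets)
qed

section \<open>Decomposition by the last crossing and by the \<open>k\<close>-subsets of small
  p-values\<close>

lemma (in prob_space) prob_crosses:
  fixes P :: "'i \<Rightarrow> 'a \<Rightarrow> real" and a :: "nat \<Rightarrow> real"
  assumes fin: "finite I" and P: "\<And>j. j \<in> I \<Longrightarrow> P j \<in> borel_measurable M"
    and mono: "mono_on {k..card I} a"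
  defines "n \<equiv> card I"
  defines "A \<equiv> \<lambda>J r s. prob {\<omega>\<in>space M. crosses (I - J) k n a r (\<lambda>j. P j \<omega>) \<and> (\<forall>j\<in>J. P j \<omega> \<le> a s)}"
  shows "prob {\<omega>\<in>space M. crosses I 0 n a k (\<lambda>j. P j \<omega>)}
    = (\<Sum>J | J \<subseteq> I \<and> card J = k. \<Sum>r=k..n. (A J r r - A J (Suc r) r) / (r choose k))"
proof -
  let ?\<J> = "{J. J \<subseteq> I \<and> card J = k}"
  define E where "E r = {\<omega>\<in>space M. crosses I 0 n a r (\<lambda>j. P j \<omega>)}" for r
  define F where "F J r s = {\<omega>\<in>space M. crosses (I - J) k n a r (\<lambda>j. P j \<omega>) \<and> (\<forall>j\<in>J. P j \<omega> \<le> a s)}"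
    for J r s
  have finJ: "finite ?\<J>" using fin by auto
  have E[measurable]: "E r \<in> sets M" for r
    unfolding E_def using fin P by (rule crosses_measurable)
  have F[measurable]: "F J r s \<in> sets M" if "J \<subseteq> I" for J r s
    unfolding F_def using fin P that
    by (intro sets.sets_Collect_conj crosses_measurable sets.sets_Collect_finite_All borel_measurable_le)
      (auto intro: finite_subset)
  have Emono: "E (Suc r) \<subseteq> E r" for r
    by (auto simp: E_def intro: crosses_antimono_index[rotated])
  have tel: "prob (E k) - prob (E (Suc n)) = (\<Sum>r=k..n. prob (E r) - prob (E (Suc r)))" if "k \<le> n"
    using sum_Suc_diff[of k n "\<lambda>r. - prob (E r)"] that by (simp add: sum_negf)
  \<comment> \<open>The telescoping sum ends in the impossible event; for k > n the first event is
    impossible too and the sum is empty.\<close>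
  have "E (Suc n) = {}" by (auto simp: E_def crosses_def)
  moreover have "E k = {}" if "\<not> k \<le> n" using that by (auto simp: E_def crosses_def)
  ultimately have "prob (E k) = (\<Sum>r=k..n. prob (E r) - prob (E (Suc r)))"
    using tel by (cases "k \<le> n") auto
  also have "\<dots> = (\<Sum>r=k..n. \<Sum>J\<in>?\<J>. (A J r r - A J (Suc r) r) / (r choose k))"
  proof (rule sum.cong)
    fix r assume r: "r \<in> {k..n}"
    have pos: "0 < r choose k" using r by simp
    \<comment> \<open>Double counting, to be integrated below: when \<open>r\<close> is the last
      crossing, exactly \<open>r choose k\<close> of the sets \<open>J\<close> have all their
      p-values at most \<open>a r\<close>; otherwise every summand vanishes.\<close>
    have pt: "real (r choose k) * indicator (E r - E (Suc r)) \<omega>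
        = (\<Sum>J\<in>?\<J>. indicator (F J r r - F J (Suc r) r) \<omega>)" for \<omega>
    proof (cases "\<omega> \<in> E r - E (Suc r)")
      case True
      have c: "count_le I (\<lambda>j. P j \<omega>) (a r) = r"
        using True r mono by (intro count_le_last_crossing[OF fin]) (auto simp: E_def n_def)
      have "(\<Sum>J\<in>?\<J>. indicator (F J r r - F J (Suc r) r) \<omega> :: real)
        = (\<Sum>J\<in>?\<J>. if \<forall>j\<in>J. P j \<omega> \<le> a r then 1 else 0)"
      proof (rule sum.cong)
        fix J assume J: "J \<in> ?\<J>"
        show "(indicator (F J r r - F J (Suc r) r) \<omega> :: real) = (if \<forall>j\<in>J. P j \<omega> \<le> a r then 1 else 0)"
          using True J r crosses_remove[OF fin, of J k n a r _ "\<lambda>j. P j \<omega>"] mono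
          by (auto simp: E_def F_def n_def)
      qed simp
      also have "\<dots> = card {J. J \<subseteq> I \<and> card J = k \<and> (\<forall>j\<in>J. P j \<omega> \<le> a r)}"
        using finJ by (subst sum.If_cases) (auto intro!: arg_cong[where f=card])
      also have "\<dots> = r choose k" by (simp add: card_subsets_le[OF fin] c)
      finally show ?thesis using True by simp
    next
      case False
      \<comment> \<open>Putting the small p-values in \<open>J\<close> back would make
        \<open>r\<close> the last crossing of the full vector.\<close>
      have "\<omega> \<notin> F J r r - F J (Suc r) r" if J: "J \<in> ?\<J>" for J
        using False J r crosses_remove[OF fin, of J k n a r _ "\<lambda>j. P j \<omega>"] mono
        by (auto simp: E_def F_def n_def)
      then show ?thesis using False by (auto intro!: sum.neutral[symmetric])
    qed
    have "real (r choose k) * prob (E r - E (Suc r))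
        = (\<integral>\<omega>. real (r choose k) * indicator (E r - E (Suc r)) \<omega> \<partial>M)" by simp
    also have "\<dots> = (\<integral>\<omega>. (\<Sum>J\<in>?\<J>. indicator (F J r r - F J (Suc r) r) \<omega>) \<partial>M)"
      by (simp add: pt)
    also have "\<dots> = (\<Sum>J\<in>?\<J>. prob (F J r r - F J (Suc r) r))"
      by (subst Bochner_Integration.integral_sum) (auto simp: less_top[symmetric])
    also have "\<dots> = (\<Sum>J\<in>?\<J>. A J r r - A J (Suc r) r)"
    proof (rule sum.cong)
      fix J assume J: "J \<in> ?\<J>"
      have "F J (Suc r) r \<subseteq> F J r r"
        by (auto simp: F_def intro: crosses_antimono_index[rotated])
      then show "prob (F J r r - F J (Suc r) r) = A J r r - A J (Suc r) r"
        using J by (subst finite_measure_Diff) (auto simp: A_def F_def[symmetric])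
    qed simp
    finally have "prob (E r - E (Suc r)) = (\<Sum>J\<in>?\<J>. A J r r - A J (Suc r) r) / (r choose k)"
      using pos by (simp add: field_simps)
    then show "prob (E r) - prob (E (Suc r)) = (\<Sum>J\<in>?\<J>. (A J r r - A J (Suc r) r) / (r choose k))"
      using Emono by (subst (asm) finite_measure_Diff) (auto simp: sum_divide_distrib)
  qed simp
  also have "\<dots> = (\<Sum>J\<in>?\<J>. \<Sum>r=k..n. (A J r r - A J (Suc r) r) / (r choose k))"
    by (rule sum.swap)
  finally show ?thesis by (simp add: E_def)
qed

section \<open>Crossings outside \<open>J\<close> given small p-values in \<open>J\<close>:
  independence and MTP2\<close>

lemma (in prob_space) indep_vars_prob_crosses:
  fixes P :: "'i \<Rightarrow> 'a \<Rightarrow> real"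
  assumes fin: "finite I" and ind: "indep_vars (\<lambda>_. borel) P I" and J: "J \<subseteq> I"
  shows "prob {\<omega>\<in>space M. crosses (I - J) k n a r (\<lambda>j. P j \<omega>) \<and> (\<forall>j\<in>J. P j \<omega> \<le> t)}
    = prob {\<omega>\<in>space M. crosses (I - J) k n a r (\<lambda>j. P j \<omega>)} * prob {\<omega>\<in>space M. \<forall>j\<in>J. P j \<omega> \<le> t}"
proof -
  let ?K = "I - J"
  let ?U = "{x \<in> space (PiM ?K (\<lambda>_. borel)). crosses ?K k n a r (\<lambda>j. x j)}"
  let ?V = "{x \<in> space (PiM J (\<lambda>_. borel)). \<forall>j\<in>J. x j \<le> t}"
  have iv: "indep_var (PiM ?K (\<lambda>_. borel)) (\<lambda>\<omega>. restrict (\<lambda>i. P i \<omega>) ?K)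
      (PiM J (\<lambda>_. borel)) (\<lambda>\<omega>. restrict (\<lambda>i. P i \<omega>) J)"
    using J by (intro indep_var_restrict[OF ind]) auto
  have U: "?U \<in> sets (PiM ?K (\<lambda>_. borel))"
    using fin by (intro crosses_measurable) auto
  have V: "?V \<in> sets (PiM J (\<lambda>_. borel))"
    using fin J by (intro sets.sets_Collect_finite_All borel_measurable_le) (auto intro: finite_subset)
  \<comment> \<open>The event is a function of the coordinates outside \<open>J\<close> alone, so it
    can be set against the independent block \<open>J\<close>.\<close>
  have restr: "crosses ?K k n a r (restrict p ?K) = crosses ?K k n a r p" for p
    using crosses_lower[of ?K p "restrict p ?K" k n a r] crosses_lower[of ?K "restrict p ?K" p k n a r] fin
    by auto
  show ?thesis
    using indep_varD[OF iv U V]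
    by (simp add: vimage_def Int_def space_PiM restr conj_ac)
qed

text \<open>Take a point with a crossing and \<open>J\<close>-coordinates at most \<open>t\<close>,
  and another with \<open>J\<close>-coordinates at most \<open>s\<close>. Their meet keeps the
  crossing, being below the first point, and has \<open>J\<close>-coordinates at most
  \<open>s\<close>; their join has \<open>J\<close>-coordinates at most \<open>t\<close>.
  \<open>MTP2_meet_join\<close> then applies.\<close>

lemma MTP2_prob_crosses:
  fixes P :: "'i \<Rightarrow> 'a \<Rightarrow> real"
  assumes "prob_space M" and fin: "finite I" and "MTP2 M I P" and J: "J \<subseteq> I" and "s \<le> t"
  shows "measure M {\<omega>\<in>space M. crosses (I - J) k n a r (\<lambda>j. P j \<omega>) \<and> (\<forall>j\<in>J. P j \<omega> \<le> t)}
      * measure M {\<omega>\<in>space M. \<forall>j\<in>J. P j \<omega> \<le> s}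
    \<le> measure M {\<omega>\<in>space M. crosses (I - J) k n a r (\<lambda>j. P j \<omega>) \<and> (\<forall>j\<in>J. P j \<omega> \<le> s)}
      * measure M {\<omega>\<in>space M. \<forall>j\<in>J. P j \<omega> \<le> t}"
proof -
  let ?\<Pi> = "PiM I (\<lambda>_. borel) :: ('i \<Rightarrow> real) measure"
  define C where "C u = {x \<in> space ?\<Pi>. crosses (I - J) k n a r (\<lambda>j. x j) \<and> (\<forall>j\<in>J. x j \<le> u)}" for u
  define B where "B u = {x \<in> space ?\<Pi>. \<forall>j\<in>J. x j \<le> u}" for u
  have finJ: "finite J" using fin J by (rule finite_subset[rotated])
  have B: "B u \<in> sets ?\<Pi>" for u
    unfolding B_def using finJ J by (intro sets.sets_Collect_finite_All borel_measurable_le) auto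
  have C: "C u \<in> sets ?\<Pi>" for u
    unfolding C_def using fin finJ J
    by (intro sets.sets_Collect_conj crosses_measurable sets.sets_Collect_finite_All borel_measurable_le) auto
  have restr: "crosses (I - J) k n a r (restrict p I) = crosses (I - J) k n a r p" for p
    using crosses_lower[of "I - J" p "restrict p I" k n a r]
      crosses_lower[of "I - J" "restrict p I" p k n a r] fin
    by auto
  have eq: "{\<omega>\<in>space M. (\<lambda>i\<in>I. P i \<omega>) \<in> C u}
      = {\<omega>\<in>space M. crosses (I - J) k n a r (\<lambda>j. P j \<omega>) \<and> (\<forall>j\<in>J. P j \<omega> \<le> u)}"
    "{\<omega>\<in>space M. (\<lambda>i\<in>I. P i \<omega>) \<in> B u} = {\<omega>\<in>space M. \<forall>j\<in>J. P j \<omega> \<le> u}" for u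
    using J by (auto simp: C_def B_def space_PiM restr subset_eq)
  show ?thesis
    unfolding eq[symmetric]
  proof (rule MTP2_meet_join[OF assms(1-3) C B C B])
    fix x y assume x: "x \<in> C t" and y: "y \<in> B s"
    show "(\<lambda>i\<in>I. min (x i) (y i)) \<in> C s"
      using x y J fin crosses_lower[of "I - J" "\<lambda>i\<in>I. min (x i) (y i)" x k n a r]
      by (auto simp: C_def B_def space_PiM subset_eq min_le_iff_disj)
    show "(\<lambda>i\<in>I. max (x i) (y i)) \<in> B t"
      using x y J \<open>s \<le> t\<close> by (force simp: C_def B_def space_PiM subset_eq)
  qed
qed

section \<open>Insertion of the critical values, and the two bounds\<close>

lemma binomial_ratio_prod:
  "(\<Prod>j<k. real i - real j) / (\<Prod>j<k. real n - real j) = real (i choose k) / real (n choose k)"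
  by (simp add: binomial_gbinomial gbinomial_prod_rev atLeast0LessThan)

theorem proposition3p1:
  fixes n k :: nat
    and \<alpha> :: real
    and H :: "nat \<Rightarrow> 'a measure set"
    and M :: "'a measure"
    and P :: "nat \<Rightarrow> 'a \<Rightarrow> real"
    and G :: "real \<Rightarrow> real"
    and a :: "nat \<Rightarrow> real"
  assumes "1 \<le> k" and "k \<le> n"
    and "0 < \<alpha>" and "\<alpha> < 1"
    and "M \<in> (\<Inter>i\<in>{1..n}. H i)" and "prob_space M"
    and "\<And>i. i \<in> {1..n} \<Longrightarrow> P i \<in> borel_measurable M"
    and "\<And>i. i \<in> {1..n} \<Longrightarrow> distr M borel (P i) = uniform_measure lborel {0<..<1}"
    and "\<And>J J'. J \<subseteq> {1..n} \<Longrightarrow> card J = k \<Longrightarrow> J' \<subseteq> {1..n} \<Longrightarrow> card J' = k \<Longrightarrow>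
           subvector_distr M P J = subvector_distr M P J'"
    and "\<And>J u. J \<subseteq> {1..n} \<Longrightarrow> card J = k \<Longrightarrow> 0 < u \<Longrightarrow> u < 1 \<Longrightarrow>
           G u = measure M {\<omega> \<in> space M. Max ((\<lambda>j. P j \<omega>) ` J) \<le> u}"
    and "mono_on {k..n} a"
    and "\<And>i. i \<in> {k..n} \<Longrightarrow> 0 < a i \<and> a i < 1"
    and "\<And>i. i \<in> {k..n} \<Longrightarrow>
           G (a i) = (\<Prod>j<k. real i - real j) / (\<Prod>j<k. real n - real j) * \<alpha>"
  shows "(prob_space.indep_vars M (\<lambda>_. borel) P {1..n} \<longrightarrow>
            kFWER M n k a P = \<alpha> \<and>
            measure M (\<Union>i\<in>{k..n}. {\<omega> \<in> space M. ordered_pval n (\<lambda>j. P j \<omega>) i \<le> a i}) = \<alpha>) \<and>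
         (MTP2 M {1..n} P \<longrightarrow>
            kFWER M n k a P \<le> \<alpha> \<and>
            measure M (\<Union>i\<in>{k..n}. {\<omega> \<in> space M. ordered_pval n (\<lambda>j. P j \<omega>) i \<le> a i}) \<le> \<alpha>)"
proof -
  interpret prob_space M by fact
  let ?I = "{1..n}"
  let ?\<J> = "{J. J \<subseteq> ?I \<and> card J = k}"
  define D where "D J r = {\<omega>\<in>space M. crosses (?I - J) k n a r (\<lambda>j. P j \<omega>)}" for J r
  define B where "B J s = {\<omega>\<in>space M. \<forall>j\<in>J. P j \<omega> \<le> a s}" for J s
  define A where "A J r s =
    prob {\<omega>\<in>space M. crosses (?I - J) k n a r (\<lambda>j. P j \<omega>) \<and> (\<forall>j\<in>J. P j \<omega> \<le> a s)}" for J r s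
  have binom: "G (a r) = real (r choose k) / real (n choose k) * \<alpha>" if "r \<in> {k..n}" for r
    using assms(13)[OF that] by (simp only: binomial_ratio_prod)
  have Gpos: "0 < G (a r)" if "r \<in> {k..n}" for r
    using that \<open>k \<le> n\<close> \<open>0 < \<alpha>\<close> by (simp add: binom)
  have B: "prob (B J r) = G (a r)" if "r \<in> {k..n}" "J \<in> ?\<J>" for r J
  proof -
    have "finite J" "J \<noteq> {}" using that \<open>1 \<le> k\<close> by (auto intro: finite_subset)
    then show ?thesis
      using assms(10)[of J "a r"] assms(12)[of r] that by (simp add: B_def)
  qed
  \<comment> \<open>The offset \<open>k\<close> alone already gives a crossing at index
    \<open>k\<close>.\<close>
  have D_first: "crosses (?I - J) k n a k p" for J p
    unfolding crosses_def using \<open>k \<le> n\<close> by (intro bexI[of _ k]) auto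
  have D_last: "\<not> crosses (?I - J) k n a (Suc n) p" for J p
    by (auto simp: crosses_def)
  have un: "(\<Union>i\<in>{k..n}. {\<omega> \<in> space M. ordered_pval n (\<lambda>j. P j \<omega>) i \<le> a i})
      = {\<omega>\<in>space M. crosses ?I 0 n a k (\<lambda>j. P j \<omega>)}"
    using \<open>1 \<le> k\<close> by (auto simp: crosses_def ordered_pval_le_iff)
  \<comment> \<open>The defining equation of the critical values turns the weight
    \<open>1 / (r choose k)\<close> into a constant times \<open>1 / G (a r)\<close>, and
    \<open>G (a r)\<close> is the probability of the conditioning event.\<close>
  have mainsum: "prob {\<omega>\<in>space M. crosses ?I 0 n a k (\<lambda>j. P j \<omega>)}
      = \<alpha> / (n choose k) * (\<Sum>J\<in>?\<J>. \<Sum>r=k..n. (A J r r - A J (Suc r) r) / G (a r))"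
  proof -
    have "prob {\<omega>\<in>space M. crosses ?I 0 n a k (\<lambda>j. P j \<omega>)}
      = (\<Sum>J\<in>?\<J>. \<Sum>r=k..n. (A J r r - A J (Suc r) r) / (r choose k))"
      using prob_crosses[of ?I P k a] assms(7,11) by (simp add: A_def)
    also have "\<dots> = (\<Sum>J\<in>?\<J>. \<Sum>r=k..n. \<alpha> / (n choose k) * ((A J r r - A J (Suc r) r) / G (a r)))"
      using \<open>k \<le> n\<close> \<open>0 < \<alpha>\<close> by (intro sum.cong refl) (simp add: binom)
    finally show ?thesis by (simp add: sum_distrib_left)
  qed
  have cardJ: "card ?\<J> = n choose k" using n_subsets[of ?I k] by simp
  have tel: "(\<Sum>r=k..n. f r - f (Suc r)) = f k - f (Suc n)" for f :: "nat \<Rightarrow> real"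
    using sum_Suc_diff[of k n "\<lambda>r. - f r"] \<open>k \<le> n\<close> by (simp add: sum_negf)
  have indep: "prob {\<omega>\<in>space M. crosses ?I 0 n a k (\<lambda>j. P j \<omega>)} = \<alpha>"
    if ind: "indep_vars (\<lambda>_. borel) P ?I"
  proof -
    have "(\<Sum>r=k..n. (A J r r - A J (Suc r) r) / G (a r)) = 1" if J: "J \<in> ?\<J>" for J
    proof -
      \<comment> \<open>The factor \<open>G (a r)\<close> cancels, leaving a sum that telescopes
        from the sure event to the impossible one.\<close>
      have "A J r s = prob (D J r) * G (a s)" if "s \<in> {k..n}" for r s
        using indep_vars_prob_crosses[OF _ ind, of J k n a r "a s"] J B[OF that J]
        by (simp add: A_def D_def B_def)
      then have "(\<Sum>r=k..n. (A J r r - A J (Suc r) r) / G (a r))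
          = (\<Sum>r=k..n. prob (D J r) - prob (D J (Suc r)))"
        using Gpos by (intro sum.cong refl) (force simp: field_simps)
      then show ?thesis
        using tel[of "\<lambda>r. prob (D J r)"] by (simp add: D_def D_first[simplified] D_last[simplified] prob_space)
    qed
    then have "(\<Sum>J\<in>?\<J>. \<Sum>r=k..n. (A J r r - A J (Suc r) r) / G (a r)) = (\<Sum>J\<in>?\<J>. 1)"
      by (rule sum.cong[OF refl])
    also have "\<dots> = real (n choose k)" using cardJ by simp
    finally show ?thesis
      unfolding mainsum using \<open>k \<le> n\<close> by simp
  qed
  have mtp: "prob {\<omega>\<in>space M. crosses ?I 0 n a k (\<lambda>j. P j \<omega>)} \<le> \<alpha>" if mt: "MTP2 M ?I P"
  proof -
    have le1: "(\<Sum>r=k..n. (A J r r - A J (Suc r) r) / G (a r)) \<le> 1" if J: "J \<in> ?\<J>" for J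
    proof -
      \<comment> \<open>The conditional probability of a crossing from \<open>r\<close> on, given
        that the p-values in \<open>J\<close> are at most \<open>a r\<close>. Passing from
        \<open>a (Suc r)\<close> to the smaller level \<open>a r\<close> can only raise the
        probability subtracted, so each summand is at most \<open>f r - f (Suc r)\<close>.\<close>
      define f where "f r = A J r r / G (a r)" for r
      have last: "A J (Suc n) s = 0" for s by (simp add: A_def D_last[simplified])
      have "(A J r r - A J (Suc r) r) / G (a r) \<le> f r - f (Suc r)" if r: "r \<in> {k..n}" for r
      proof (cases "r = n")
        case True
        then show ?thesis by (simp add: f_def last)
      next
        case False
        then have r': "Suc r \<in> {k..n}" using r by auto
        have "a r \<le> a (Suc r)" using assms(11) r r' by (auto intro: mono_onD)
        then have "A J (Suc r) (Suc r) * prob (B J r) \<le> A J (Suc r) r * prob (B J (Suc r))"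
          using MTP2_prob_crosses[OF \<open>prob_space M\<close> _ mt, of J "a r" "a (Suc r)" k n a "Suc r"] J
          by (simp add: A_def B_def)
        then have "f (Suc r) \<le> A J (Suc r) r / G (a r)"
          using Gpos[OF r] Gpos[OF r'] B[OF r J] B[OF r' J] by (simp add: f_def field_simps)
        then show ?thesis by (simp add: f_def diff_divide_distrib)
      qed
      then have "(\<Sum>r=k..n. (A J r r - A J (Suc r) r) / G (a r)) \<le> (\<Sum>r=k..n. f r - f (Suc r))"
        by (rule sum_mono)
      also have "\<dots> = A J k k / G (a k)" using tel[of f] by (simp add: f_def last)
      also have "A J k k = G (a k)" using B[of k J] J \<open>k \<le> n\<close> by (simp add: A_def B_def D_first[simplified])
      finally show ?thesis using Gpos[of k] \<open>k \<le> n\<close> by simp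
    qed
    have "(\<Sum>J\<in>?\<J>. \<Sum>r=k..n. (A J r r - A J (Suc r) r) / G (a r)) \<le> (\<Sum>J\<in>?\<J>. 1)"
      by (rule sum_mono) (rule le1)
    also have "\<dots> = real (n choose k)" using cardJ by simp
    finally show ?thesis
      unfolding mainsum using \<open>0 < \<alpha>\<close> \<open>k \<le> n\<close> by (simp add: field_simps)
  qed
  show ?thesis
    unfolding kFWER_eq[OF \<open>1 \<le> k\<close>] un using indep mtp by blast
qed

end
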